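(* Let $n$ and $\ell$ be integers with $n\ge 3\ell^2$ and $\ell\ge 6$, and let $S_\ell$ be the star on $\ell$ vertices (one center and $\ell-1$ leaves). Then $\operatorname{rwsat}(n,S_\ell)=\binom{\ell}{2}-1$. Furthermore, the extremal graphs are not unique: there are at least two non-isomorphic (as uncolored graphs) $n$-vertex graphs with $\binom{\ell}{2}-1$ edges which, with a suitable edge coloring, are weakly $S_\ell$-rainbow saturated.
   Context: All graphs are finite and simple; $\bar F$ is the complement of $F$. Colors are taken from an infinite set. An edge-colored graph is rainbow if all its edges receive distinct colors. For a fixed graph $H$, an edge-colored graph $F$ is weakly $H$-rainbow saturated if there is an ordering $e_1,\dots,e_m$ of $E(\bar F)$, $m=|E(\bar F)|$, such that for every injective coloring $c$ of $E(\bar F)$ (distinct edges of $\bar F$ get distinct colors, but these may coincide with colors used on $E(F)$) and every $1\le i\le m$, the edge-colored graph $F+\{e_1,\dots,e_i\}$ contains a rainbow copy of $H$ containing $e_i$. The weak rainbow saturation number $\operatorname{rwsat}(n,H)$ is the minimum number of edges of a weakly $H$-rainbow saturated (edge-colored) graph on $n$ vertices. *)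

theory Defs
  imports "HOL-Library.Ramsey" "HOL-Library.FuncSet"
begin

record 'a ugraph =
  verts :: "'a set"
  edges :: "'a set set"

text \<open>From \<^theory>\<open>HOL-Library.Ramsey\<close>: \<open>[V]\<^bsup>2\<^esup>\<close>, i.e. \<^term>\<open>nsets V 2\<close>, is the set of all
  two-element subsets of \<open>V\<close>.\<close>

definition simple_graph :: "'a ugraph \<Rightarrow> bool" where
  "simple_graph G \<longleftrightarrow> finite (verts G) \<and> edges G \<subseteq> nsets (verts G) 2"

definition non_edges :: "'a ugraph \<Rightarrow> 'a set set" where
  "non_edges G = nsets (verts G) 2 - edges G"

definition add_edges :: "'a ugraph \<Rightarrow> 'a set set \<Rightarrow> 'a ugraph" where
  "add_edges G S = \<lparr>verts = verts G, edges = edges G \<union> S\<rparr>"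

definition subgraph :: "'a ugraph \<Rightarrow> 'a ugraph \<Rightarrow> bool" where
  "subgraph K G \<longleftrightarrow> simple_graph K \<and> verts K \<subseteq> verts G \<and> edges K \<subseteq> edges G"

definition isomorphic :: "'a ugraph \<Rightarrow> 'b ugraph \<Rightarrow> bool" where
  "isomorphic G H \<longleftrightarrow>
     (\<exists>f. bij_betw f (verts G) (verts H) \<and> edges H = (\<lambda>e. f ` e) ` edges G)"

text \<open>An edge-colored graph is a graph together with a function on sets of vertices, of which
  only the values on the edges are relevant.\<close>

definition rainbow :: "('a set \<Rightarrow> 'c) \<Rightarrow> 'a ugraph \<Rightarrow> bool" where
  "rainbow col G \<longleftrightarrow> inj_on col (edges G)"

definition has_rainbow_copy_containing ::
    "'b ugraph \<Rightarrow> 'a ugraph \<Rightarrow> ('a set \<Rightarrow> 'c) \<Rightarrow> 'a set \<Rightarrow> bool" where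
  "has_rainbow_copy_containing H G col e \<longleftrightarrow>
     (\<exists>K. subgraph K G \<and> isomorphic K H \<and> rainbow col K \<and> e \<in> edges K)"

text \<open>\<open>C\<close> is the set of available colors. The ordering \<open>es\<close> of the non-edges of \<open>F\<close> is chosen before
  their coloring \<open>c\<close>; the combined coloring is \<open>col\<close> on the edges of \<open>F\<close> and \<open>c\<close> elsewhere.\<close>

definition weakly_rainbow_saturated ::
    "'c set \<Rightarrow> 'b ugraph \<Rightarrow> 'a ugraph \<Rightarrow> ('a set \<Rightarrow> 'c) \<Rightarrow> bool" where
  "weakly_rainbow_saturated C H F col \<longleftrightarrow>
     simple_graph F \<and> col \<in> edges F \<rightarrow> C \<and>
     (\<exists>es. distinct es \<and> set es = non_edges F \<and>
        (\<forall>c. c \<in> non_edges F \<rightarrow> C \<and> inj_on c (non_edges F) \<longrightarrow>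
           (\<forall>i<length es.
              has_rainbow_copy_containing H (add_edges F (set (take (Suc i) es)))
                (override_on c col (edges F)) (es ! i))))"

text \<open>For nonempty \<open>C\<close> the minimum ranges over a nonempty set, since complete graphs are (vacuously)
  weakly saturated. Every finite graph is isomorphic to one with vertices in \<^typ>\<open>nat\<close>.\<close>

definition rwsat :: "'c set \<Rightarrow> nat \<Rightarrow> 'b ugraph \<Rightarrow> nat" where
  "rwsat C n H =
     (LEAST m. \<exists>(F :: nat ugraph) col.
        card (verts F) = n \<and> weakly_rainbow_saturated C H F col \<and> card (edges F) = m)"

text \<open>The star on \<open>l\<close> vertices (not \<open>l\<close> leaves), with center \<open>0\<close>.\<close>

definition star :: "nat \<Rightarrow> nat ugraph" where
  "star l = \<lparr>verts = {..<l}, edges = (\<lambda>i. {0, i}) ` {1..<l}\<rparr>"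

end

theory Submission
  imports Defs
begin

text \<open>Write \<open>l = t + 1\<close>, so that a copy of the star is a vertex with \<open>t\<close> differently colored edges.

  Upper bound: take \<open>t - 1\<close> core vertices that are pairwise adjacent and have two further neighbours
  each. With a rainbow coloring every core vertex already sees \<open>t\<close> colors, so all edges at the core can be
  added; then an isolated vertex has \<open>t - 1\<close> new edges, and new edges have distinct colors, so all its
  edges can be added; finally every vertex has at least \<open>t\<close> new edges.

  Lower bound: let \<open>S\<close> be the set of vertices that see \<open>t\<close> colors in \<open>F\<close>. If \<open>card S \<ge> t - 1\<close>, the edges
  meeting \<open>S\<close> suffice. Otherwise put \<open>q = t - 1 - card S\<close> and let \<open>u\<close> be the first vertex outside \<open>S\<close>
  that acquires \<open>t\<close> new edges. An edge that avoids \<open>S\<close> and is added before that moment can survive the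
  adversary only if at both its ends the number of old colors plus the number of new edges is at least
  \<open>t\<close>, which forces both ends to have \<open>q\<close> neighbours in \<open>F - S\<close>. There are \<open>q\<close> such new edges at \<open>u\<close>, hence
  \<open>q + 1\<close> vertices of degree at least \<open>q\<close> in \<open>F - S\<close>, with \<open>q\<close> non-adjacent pairs among them. Adding the
  edges meeting \<open>S\<close> gives exactly the bound \<open>(l choose 2) - 1\<close>, whatever the size of \<open>S\<close>.\<close>

section \<open>Edges at a vertex, and rainbow stars in terms of colors seen by a vertex\<close>

definition edges_at :: "'a set set \<Rightarrow> 'a \<Rightarrow> 'a set set" where
  "edges_at E v = {e \<in> E. v \<in> e}"

lemma finite_edges_at [simp]: "finite E \<Longrightarrow> finite (edges_at E v)"
  by (simp add: edges_at_def)

lemma edges_at_Un: "edges_at (A \<union> B) v = edges_at A v \<union> edges_at B v"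
  by (auto simp: edges_at_def)

lemma edges_at_mono: "A \<subseteq> B \<Longrightarrow> edges_at A v \<subseteq> edges_at B v"
  by (auto simp: edges_at_def)

lemma nsets2_cases:
  assumes "e \<in> nsets V 2" "v \<in> e"
  obtains w where "e = {v, w}" "v \<noteq> w" "v \<in> V" "w \<in> V"
proof -
  have "card e = 2" "e \<subseteq> V"
    using assms by (auto simp: nsets_def)
  then obtain a b where "e = {a, b}" "a \<noteq> b"
    by (auto simp: card_2_iff)
  with \<open>v \<in> e\<close> \<open>e \<subseteq> V\<close> show thesis
    using that[of a] that[of b] by (auto simp: insert_commute)
qed

lemma doubleton_in_nsets: "x \<in> V \<Longrightarrow> y \<in> V \<Longrightarrow> x \<noteq> y \<Longrightarrow> {x, y} \<in> nsets V 2"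
  by (simp add: nsets_def)

lemma inj_on_doubleton: "inj_on (\<lambda>w. {v, w}) A"
  by (auto simp: inj_on_def doubleton_eq_iff)

lemma finite_nsets2: "finite V \<Longrightarrow> finite (nsets V 2)"
  by (rule finite_imp_finite_nsets)

lemma simple_graph_finite_edges: "simple_graph G \<Longrightarrow> finite (edges G)"
  unfolding simple_graph_def using finite_nsets2 finite_subset by blast

lemma card_edges_star: "card (edges (star (Suc t))) = t"
proof -
  have "inj_on (\<lambda>i::nat. {0, i}) {1..<Suc t}"
    by (rule inj_on_doubleton)
  then show ?thesis
    by (simp add: star_def card_image)
qed

lemma isomorphic_card_edges:
  assumes "isomorphic G H" "edges G \<subseteq> Pow (verts G)"
  shows "card (edges G) = card (edges H)"
proof -
  obtain f where f: "bij_betw f (verts G) (verts H)" "edges H = (`) f ` edges G"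
    using assms(1) unfolding isomorphic_def by blast
  have "inj_on ((`) f) (edges G)"
    using f(1) assms(2) by (meson bij_betw_def inj_on_image_Pow inj_on_subset)
  with f(2) show ?thesis
    by (simp add: card_image)
qed

text \<open>The union of the edges consists of the non-isolated vertices. Their number is the
  invariant that later separates the two extremal graphs.\<close>

lemma isomorphic_card_Union_edges:
  assumes "isomorphic G H" "edges G \<subseteq> Pow (verts G)"
  shows "card (\<Union> (edges G)) = card (\<Union> (edges H))"
proof -
  obtain f where f: "bij_betw f (verts G) (verts H)" "edges H = (`) f ` edges G"
    using assms(1) unfolding isomorphic_def by blast
  have "inj_on f (\<Union> (edges G))"
  proof (rule inj_on_subset)
    show "inj_on f (verts G)" using f(1) by (rule bij_betw_imp_inj_on)
  qed (use assms(2) in blast)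
  moreover have "\<Union> (edges H) = f ` \<Union> (edges G)"
    using f(2) by (simp add: image_Union)
  ultimately show ?thesis
    by (simp add: card_image)
qed

text \<open>Edges through \<open>z\<close> are determined by their other ends, so sending
  \<open>z\<close> to \<open>0\<close> and numbering the other ends from \<open>1\<close> to
  \<open>t\<close> works. Positivity of \<open>t\<close> puts \<open>z\<close> into
  \<open>\<Union> M\<close>. Besides producing copies of the star, this counts the vertices spanned
  by edges with a common end.\<close>

lemma spanned_star_isomorphic:
  assumes M: "M \<subseteq> edges_at (nsets V 2) z" and "card M = t" "t > 0"
  shows "isomorphic \<lparr>verts = \<Union> M, edges = M\<rparr> (star (Suc t))"
proof -
  define L where "L = \<Union> M - {z}"
  have M_eq: "M = (\<lambda>w. {z, w}) ` L"
  proof (intro set_eqI iffI)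
    fix e assume "e \<in> M"
    then have "e \<in> nsets V 2" "z \<in> e" using M by (auto simp: edges_at_def)
    then obtain w where "e = {z, w}" "z \<noteq> w" by (rule nsets2_cases)
    with \<open>e \<in> M\<close> show "e \<in> (\<lambda>w. {z, w}) ` L" by (auto simp: L_def)
  next
    fix e assume "e \<in> (\<lambda>w. {z, w}) ` L"
    then obtain w e' where w: "e = {z, w}" "w \<noteq> z" "e' \<in> M" "w \<in> e'"
      by (auto simp: L_def)
    then have "e' \<in> nsets V 2" "z \<in> e'" using M by (auto simp: edges_at_def)
    then obtain w' where "e' = {z, w'}" by (rule nsets2_cases)
    with w show "e \<in> M" by auto
  qed
  have "card L = t"
    using \<open>card M = t\<close> M_eq by (simp add: card_image inj_on_doubleton)
  with \<open>t > 0\<close> have "finite L" "L \<noteq> {}" by (auto intro: card_ge_0_finite)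
  then obtain h where h: "bij_betw h L {1..<Suc t}"
    using \<open>card L = t\<close> finite_same_card_bij[of L "{1..<Suc t}"] by auto
  define f where "f = h(z := 0)"
  have zL: "z \<notin> L" by (simp add: L_def)
  have "f z = 0" by (simp add: f_def)
  have fh: "f w = h w" if "w \<in> L" for w
    using that zL by (auto simp: f_def)
  have bij: "bij_betw f L {1..<Suc t}"
    using h fh by (metis bij_betw_cong)
  have "bij_betw f (insert z L) (insert 0 {1..<Suc t})"
    using notIn_Un_bij_betw[of z L f "{1..<Suc t}"] zL bij by (simp add: f_def)
  moreover have "insert z L = \<Union> M"
    using \<open>L \<noteq> {}\<close> by (auto simp: M_eq)
  moreover have "insert 0 {1..<Suc t} = {..<Suc t}" by auto
  moreover have "(\<lambda>i. {0, i}) ` {1..<Suc t} = (`) f ` M"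
  proof -
    have "(`) f ` M = (\<lambda>w. {0, f w}) ` L"
      using \<open>f z = 0\<close> by (simp add: M_eq image_image)
    also have "\<dots> = (\<lambda>i. {0, i}) ` f ` L" by (simp add: image_image)
    also have "f ` L = {1..<Suc t}" using bij by (simp add: bij_betw_def)
    finally show ?thesis by simp
  qed
  ultimately show ?thesis
    unfolding isomorphic_def star_def by (intro exI[of _ f]) simp
qed

text \<open>The center of a star lies on all its edges, in particular on \<open>e\<close>.
  Conversely, if an end of \<open>e\<close> sees \<open>t\<close> colors, at most one of them is
  lost by excluding \<open>col e\<close>, so \<open>t - 1\<close> edges with other distinct colors
  remain to complete \<open>e\<close> to a rainbow star.\<close>

lemma has_rainbow_star_iff:
  assumes G: "simple_graph G" and "t > 0"
  shows "has_rainbow_copy_containing (star (Suc t)) G col e \<longleftrightarrow>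
    e \<in> edges G \<and> (\<exists>z\<in>e. t \<le> card (col ` edges_at (edges G) z))"
proof
  assume "has_rainbow_copy_containing (star (Suc t)) G col e"
  then obtain K where K: "subgraph K G" "isomorphic K (star (Suc t))" "rainbow col K" "e \<in> edges K"
    unfolding has_rainbow_copy_containing_def by blast
  obtain f where f: "bij_betw f (verts K) (verts (star (Suc t)))"
      "edges (star (Suc t)) = (`) f ` edges K"
    using K(2) unfolding isomorphic_def by blast
  have sub: "edges K \<subseteq> Pow (verts K)" "edges K \<subseteq> edges G"
    using K(1) by (auto simp: subgraph_def simple_graph_def nsets_def)
  have "0 \<in> verts (star (Suc t))" by (simp add: star_def)
  then obtain z where z: "z \<in> verts K" "f z = 0"
    using f(1) unfolding bij_betw_def by (metis imageE)
  have at_z: "z \<in> e'" if "e' \<in> edges K" for e'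
  proof -
    have "f ` e' \<in> edges (star (Suc t))" using that f(2) by blast
    then have "0 \<in> f ` e'" by (auto simp: star_def)
    then obtain x where "x \<in> e'" "f x = 0" by force
    with sub that z f(1) show "z \<in> e'" by (metis PowD bij_betw_def inj_onD subsetD)
  qed
  have "t = card (edges K)"
    using isomorphic_card_edges[OF K(2) sub(1)] by (simp add: card_edges_star)
  also have "\<dots> = card (col ` edges K)"
    using K(3) by (simp add: rainbow_def card_image)
  also have "\<dots> \<le> card (col ` edges_at (edges G) z)"
    using at_z sub simple_graph_finite_edges[OF G]
    by (intro card_mono image_mono) (auto simp: edges_at_def)
  finally show "e \<in> edges G \<and> (\<exists>z\<in>e. t \<le> card (col ` edges_at (edges G) z))"
    using at_z K(4) sub by blast
next
  assume asm: "e \<in> edges G \<and> (\<exists>z\<in>e. t \<le> card (col ` edges_at (edges G) z))"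
  then obtain z where z: "e \<in> edges G" "z \<in> e" "t \<le> card (col ` edges_at (edges G) z)"
    by blast
  define A where "A = {e' \<in> edges_at (edges G) z. col e' \<noteq> col e}"
  have fin: "finite (edges_at (edges G) z)"
    using simple_graph_finite_edges[OF G] by simp
  have "col ` A = col ` edges_at (edges G) z - {col e}"
    by (auto simp: A_def)
  moreover have "col e \<in> col ` edges_at (edges G) z"
    using z by (auto simp: edges_at_def)
  ultimately have "card (col ` A) = card (col ` edges_at (edges G) z) - 1"
    using fin by simp
  then have "t - 1 \<le> card (col ` A)" using z(3) by simp
  then obtain D where D: "D \<subseteq> col ` A" "card D = t - 1"
    by (meson obtain_subset_with_card_n)
  then obtain M where M: "M \<subseteq> A" "inj_on col M" "D = col ` M"
    by (auto simp: subset_image_inj)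
  have "finite M" using M(1) fin by (auto simp: A_def intro: finite_subset)
  have "e \<notin> M" using M(1) by (auto simp: A_def)
  have card: "card (insert e M) = t"
    using \<open>finite M\<close> \<open>e \<notin> M\<close> D(2) M(2,3) \<open>t > 0\<close> by (simp add: card_image)
  have sub: "insert e M \<subseteq> edges_at (edges G) z"
    using M(1) z by (auto simp: A_def edges_at_def)
  have edges: "edges G \<subseteq> nsets (verts G) 2" using G by (simp add: simple_graph_def)
  have inj: "inj_on col (insert e M)"
    using M by (auto simp: inj_on_insert A_def)
  let ?K = "\<lparr>verts = \<Union> (insert e M), edges = insert e M\<rparr>"
  have "isomorphic ?K (star (Suc t))"
    using sub edges card \<open>t > 0\<close> edges_at_mono[OF edges]
    by (intro spanned_star_isomorphic[where V = "verts G"]) auto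
  moreover have "subgraph ?K G"
  proof -
    have in_nsets: "insert e M \<subseteq> nsets (verts G) 2"
      using sub edges by (auto simp: edges_at_def)
    then have "\<Union> (insert e M) \<subseteq> verts G" by (auto simp: nsets_def)
    moreover have "finite (\<Union> (insert e M))"
      using calculation G by (auto simp: simple_graph_def intro: finite_subset)
    ultimately show ?thesis
      using sub in_nsets by (auto simp: subgraph_def simple_graph_def nsets_def edges_at_def)
  qed
  ultimately show "has_rainbow_copy_containing (star (Suc t)) G col e"
    using inj unfolding has_rainbow_copy_containing_def rainbow_def
    by (intro exI[of _ ?K]) simp
qed

lemma simple_graph_add_edges:
  "simple_graph F \<Longrightarrow> T \<subseteq> non_edges F \<Longrightarrow> simple_graph (add_edges F T)"
  by (auto simp: simple_graph_def add_edges_def non_edges_def)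

section \<open>Upper bound\<close>

text \<open>Turns a process in rounds, with \<open>r\<close> as the number of the round, into an
  ordering: sort by \<open>r\<close>. The order inside a round is left open.\<close>

lemma sorted_enumeration:
  fixes r :: "'b \<Rightarrow> nat"
  assumes "finite N"
  obtains es where "distinct es" "set es = N"
    "\<And>i e. i < length es \<Longrightarrow> e \<in> N \<Longrightarrow> r e < r (es ! i) \<Longrightarrow> e \<in> set (take (Suc i) es)"
proof -
  obtain xs where xs: "set xs = N" "distinct xs"
    using assms finite_distinct_list by blast
  define es where "es = sort_key r xs"
  have sorted: "sorted (map r es)" by (simp add: es_def)
  have set_es: "set es = N" "distinct es" using xs by (simp_all add: es_def)
  show thesis
  proof
    fix i e assume i: "i < length es" "e \<in> N" "r e < r (es ! i)"
    then obtain j where j: "j < length es" "es ! j = e"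
      using set_es by (metis in_set_conv_nth)
    have "j < i"
    proof (rule ccontr)
      assume "\<not> j < i"
      then have "map r es ! i \<le> map r es ! j"
        using sorted j by (intro sorted_nth_mono) auto
      with i j show False by simp
    qed
    with j i show "e \<in> set (take (Suc i) es)"
      by (auto simp: in_set_conv_nth intro!: exI[of _ j])
  qed (use set_es in auto)
qed

text \<open>\<open>S\<close> is the core and \<open>I\<close> a set of isolated vertices. Three
  rounds suffice: edges meeting \<open>S\<close>, then the other edges meeting \<open>I\<close>,
  then the rest. In the second round the edge being added is itself a new edge, which is why
  \<open>S\<close> may have only \<open>t - 1\<close> vertices.\<close>

lemma weakly_rainbow_saturated_starI:
  fixes F :: "'a ugraph"
  assumes F: "simple_graph F" and "t > 0" and col: "inj_on col (edges F)" "col \<in> edges F \<rightarrow> C"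
    and S: "S \<subseteq> verts F" "t \<le> Suc (card S)" "\<And>v. v \<in> S \<Longrightarrow> t \<le> card (edges_at (edges F) v)"
    and I: "I \<subseteq> verts F" "t \<le> card I" "\<And>v. v \<in> I \<Longrightarrow> edges_at (edges F) v = {}"
  shows "weakly_rainbow_saturated C (star (Suc t)) F col"
proof -
  define r :: "'a set \<Rightarrow> nat" where
    "r e = (if e \<inter> S \<noteq> {} then 0 else if e \<inter> I \<noteq> {} then 1 else 2)" for e
  let ?N = "non_edges F"
  have finV: "finite (verts F)" and finE: "finite (edges F)"
    using F simple_graph_finite_edges by (auto simp: simple_graph_def)
  have finN: "finite ?N"
    using finite_nsets2[OF finV] by (simp add: non_edges_def)
  have finSI: "finite S" "finite I"
    using S(1) I(1) finV finite_subset by auto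
  obtain es where es: "distinct es" "set es = ?N"
    "\<And>i e. i < length es \<Longrightarrow> e \<in> ?N \<Longrightarrow> r e < r (es ! i) \<Longrightarrow> e \<in> set (take (Suc i) es)"
    using sorted_enumeration[OF finN, of r] by blast
  have non_edgeI: "{v, w} \<in> ?N" if "v \<in> I" "w \<in> verts F" "v \<noteq> w" for v w
  proof -
    have "{v, w} \<notin> edges F" using I(3)[OF that(1)] by (auto simp: edges_at_def)
    with that I(1) show ?thesis by (auto simp: non_edges_def intro: doubleton_in_nsets)
  qed
  have "has_rainbow_copy_containing (star (Suc t)) (add_edges F (set (take (Suc i) es)))
      (override_on c col (edges F)) (es ! i)"
    if c: "inj_on c ?N" and i: "i < length es" for c i
  proof -
    define T where "T = set (take (Suc i) es)"
    define e where "e = es ! i"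
    define k where "k = override_on c col (edges F)"
    have T: "T \<subseteq> ?N" using es(2) set_take_subset by (fastforce simp: T_def)
    have eT: "e \<in> T" using i by (auto simp: T_def e_def take_Suc_conv_app_nth)
    have earlier: "e' \<in> T" if "e' \<in> ?N" "r e' < r e" for e'
      using es(3)[OF i] that by (simp add: T_def e_def)
    have e2: "e \<in> nsets (verts F) 2" using eT T by (auto simp: non_edges_def)
    have finT: "finite T" by (simp add: T_def)
    have kT: "k ` X = c ` X" if "X \<subseteq> T" for X
      using that T by (intro image_cong) (auto simp: k_def override_on_def non_edges_def)
    \<comment> \<open>New edges have distinct colors whatever the adversary does, so counting them
      at \<open>z\<close> bounds the colors seen by \<open>z\<close> from below.\<close>
    have new: "card X \<le> card (k ` edges_at (edges F \<union> T) z)" if "X \<subseteq> edges_at T z" for X z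
    proof -
      have "X \<subseteq> T" using that by (auto simp: edges_at_def)
      then have "card X = card (k ` X)"
        using kT[of X] c T by (metis card_image inj_on_subset order_trans)
      also have "\<dots> \<le> card (k ` edges_at (edges F \<union> T) z)"
        using that finE finT by (intro card_mono image_mono) (auto simp: edges_at_Un)
      finally show ?thesis .
    qed
    have "\<exists>z\<in>e. t \<le> card (k ` edges_at (edges F \<union> T) z)"
    proof -
      consider z where "z \<in> e" "z \<in> S"
        | z where "e \<inter> S = {}" "z \<in> e" "z \<in> I"
        | "e \<inter> S = {}" "e \<inter> I = {}"
        by blast
      then show ?thesis
      proof cases
        case 1
        have "t \<le> card (edges_at (edges F) z)" using S(3) 1 by simp
        also have "\<dots> = card (col ` edges_at (edges F) z)"
          using col(1) by (metis (no_types, lifting) card_image edges_at_def inj_on_subset mem_Collect_eq subsetI)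
        also have "col ` edges_at (edges F) z = k ` edges_at (edges F) z"
          by (intro image_cong) (auto simp: k_def override_on_def edges_at_def)
        also have "card \<dots> \<le> card (k ` edges_at (edges F \<union> T) z)"
          using finE finT by (intro card_mono image_mono) (auto simp: edges_at_Un)
        finally show ?thesis using 1 by blast
      next
        case 2
        have "z \<notin> S" using 2 by blast
        have "r e = 1" using 2 by (auto simp: r_def)
        \<comment> \<open>The edges from \<open>z\<close> to \<open>S\<close> are non-edges of
          \<open>F\<close> because \<open>z\<close> is isolated there, and they belong to round
          0.\<close>
        have "{z, w} \<in> T" if "w \<in> S" for w
          using that 2 S(1) \<open>z \<notin> S\<close> \<open>r e = 1\<close>
          by (intro earlier non_edgeI) (auto simp: r_def)
        then have sub: "insert e ((\<lambda>w. {z, w}) ` S) \<subseteq> edges_at T z"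
          using eT 2 by (auto simp: edges_at_def)
        have "e \<notin> (\<lambda>w. {z, w}) ` S" using 2 by auto
        then have "card (insert e ((\<lambda>w. {z, w}) ` S)) = Suc (card S)"
          using finSI by (simp add: card_image inj_on_doubleton)
        with new[OF sub] S(2) 2 show ?thesis by (metis order_trans)
      next
        case 3
        obtain z where z: "z \<in> e"
          using e2 by (fastforce simp: nsets_def)
        then have zV: "z \<in> verts F" "z \<notin> I" using e2 3 by (auto simp: nsets_def)
        have "r e = 2" using 3 by (simp add: r_def)
        \<comment> \<open>Either end of \<open>e\<close> would do as \<open>z\<close>: its edges to
          \<open>I\<close> all belong to rounds 0 and 1.\<close>
        have "{z, w} \<in> T" if "w \<in> I" for w
          using that non_edgeI[of w z] zV \<open>r e = 2\<close>
          by (intro earlier) (auto simp: r_def insert_commute)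
        then have sub: "(\<lambda>w. {z, w}) ` I \<subseteq> edges_at T z"
          by (auto simp: edges_at_def)
        have "card ((\<lambda>w. {z, w}) ` I) = card I"
          by (simp add: card_image inj_on_doubleton)
        with new[OF sub] I(2) z show ?thesis by (metis order_trans)
      qed
    qed
    with eT show ?thesis
      unfolding T_def[symmetric] e_def[symmetric] k_def[symmetric]
      by (subst has_rainbow_star_iff[OF simple_graph_add_edges[OF F T] \<open>t > 0\<close>])
        (auto simp: add_edges_def)
  qed
  with es F col show ?thesis
    unfolding weakly_rainbow_saturated_def by blast
qed

section \<open>Lower bound\<close>

text \<open>The adversary colors the new edges at the other end \<open>y\<close> inside a set of \<open>t - 1\<close> colors
  containing those already present at \<open>y\<close>; only the plain degree bound then remains at \<open>x\<close>.\<close>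

lemma adversary:
  fixes C :: "'c set"
  assumes F: "simple_graph F" and C: "infinite C" and col: "col \<in> edges F \<rightarrow> C" and "t > 0"
    and T: "T \<subseteq> non_edges F" and e: "e \<in> T" "x \<in> e"
    and sat: "\<And>c. c \<in> non_edges F \<rightarrow> C \<Longrightarrow> inj_on c (non_edges F) \<Longrightarrow>
      has_rainbow_copy_containing (star (Suc t)) (add_edges F T) (override_on c col (edges F)) e"
    and small: "\<And>z. z \<in> e \<Longrightarrow> card (col ` edges_at (edges F) z) < t"
      "\<And>z. z \<in> e \<Longrightarrow> card (edges_at T z) < t"
  shows "t \<le> card (col ` edges_at (edges F) x) + card (edges_at T x)"
proof (rule ccontr)
  assume less: "\<not> ?thesis"
  let ?N = "non_edges F"
  have finE: "finite (edges F)" using F by (rule simple_graph_finite_edges)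
  have finN: "finite ?N"
    using F finite_nsets2 by (auto simp: non_edges_def simple_graph_def)
  have finT: "finite T" using T finN finite_subset by blast
  have "e \<in> nsets (verts F) 2" using e T by (auto simp: non_edges_def)
  then obtain y where y: "e = {x, y}" using \<open>x \<in> e\<close> by (rule nsets2_cases)
  define B where "B = col ` edges_at (edges F) y"
  have B: "finite B" "B \<subseteq> C" "card B < t"
    using finE col small(1)[of y] y by (auto simp: B_def edges_at_def)
  have "infinite (C - B)" using C B(1) by simp
  then obtain B' where B': "finite B'" "card B' = t - 1 - card B" "B' \<subseteq> C - B"
    using infinite_arbitrarily_large by blast
  \<comment> \<open>The old colors at \<open>y\<close> are padded to exactly \<open>t - 1\<close>:
    too few for a star centered at \<open>y\<close>, yet enough to color injectively the new edges
    at \<open>y\<close>, of which there are fewer than \<open>t\<close>.\<close>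
  define D where "D = B \<union> B'"
  have D: "finite D" "D \<subseteq> C" "card D = t - 1"
  proof -
    have "card (B \<union> B') = card B + card B'"
      using B B' by (intro card_Un_disjoint) auto
    then show "card D = t - 1" using B(3) B'(2) by (simp add: D_def)
  qed (use B B' in \<open>auto simp: D_def\<close>)
  define P where "P = edges_at T y"
  have P: "finite P" "P \<subseteq> ?N" "card P \<le> card D"
    using finT T small(2)[of y] y D(3) by (auto simp: P_def edges_at_def)
  then obtain g where g: "g ` P \<subseteq> D" "inj_on g P"
    using card_le_inj[OF P(1) D(1)] by blast
  \<comment> \<open>All remaining non-edges get distinct colors outside \<open>D\<close>, only to
    make the whole coloring injective.\<close>
  have "infinite (C - D)" using C D(1) by simp
  then obtain R where R: "finite R" "card R = card (?N - P)" "R \<subseteq> C - D"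
    using infinite_arbitrarily_large by blast
  then obtain h where h: "bij_betw h (?N - P) R"
    using finN by (metis finite_Diff finite_same_card_bij)
  define c where "c e = (if e \<in> P then g e else h e)" for e
  have hR: "h e \<in> C - D" if "e \<in> ?N - P" for e
    using h R(3) that by (auto simp: bij_betw_def)
  have gD: "g e \<in> D" if "e \<in> P" for e using g(1) that by blast
  have hinj: "inj_on h (?N - P)" using h by (simp add: bij_betw_def)
  have "c \<in> ?N \<rightarrow> C"
    using hR gD subsetD[OF D(2)] by (auto simp: c_def)
  moreover have "inj_on c ?N"
  proof (rule inj_onI)
    fix a b assume ab: "a \<in> ?N" "b \<in> ?N" "c a = c b"
    show "a = b"
    proof (cases "a \<in> P"; cases "b \<in> P")
      assume "a \<in> P" "b \<in> P"
      with ab g(2) show ?thesis by (auto simp: c_def dest: inj_onD)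
    next
      assume "a \<notin> P" "b \<notin> P"
      with ab hinj show ?thesis by (auto simp: c_def dest: inj_onD)
    next
      assume "a \<in> P" "b \<notin> P"
      with ab gD[of a] hR[of b] show ?thesis by (auto simp: c_def)
    next
      assume "a \<notin> P" "b \<in> P"
      with ab gD[of b] hR[of a] show ?thesis by (auto simp: c_def)
    qed
  qed
  ultimately have "has_rainbow_copy_containing (star (Suc t)) (add_edges F T)
      (override_on c col (edges F)) e"
    by (rule sat)
  then obtain z where z: "z \<in> e"
      "t \<le> card (override_on c col (edges F) ` edges_at (edges F \<union> T) z)"
    using has_rainbow_star_iff[OF simple_graph_add_edges[OF F T] \<open>t > 0\<close>]
    by (auto simp: add_edges_def)
  have old_new: "override_on c col (edges F) ` edges_at (edges F \<union> T) z
      = col ` edges_at (edges F) z \<union> c ` edges_at T z" for z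
  proof -
    have "override_on c col (edges F) ` edges_at (edges F) z = col ` edges_at (edges F) z"
      by (intro image_cong) (auto simp: edges_at_def override_on_def)
    moreover have "override_on c col (edges F) ` edges_at T z = c ` edges_at T z"
      using T by (intro image_cong) (auto simp: edges_at_def override_on_def non_edges_def)
    ultimately show ?thesis by (simp add: edges_at_Un image_Un)
  qed
  \<comment> \<open>Since \<open>y\<close> sees only colors of \<open>D\<close>, the center has to
    be \<open>x\<close>, where colors are at most as many as old colors plus new edges.\<close>
  from z y consider "z = x" | "z = y" by blast
  then show False
  proof cases
    case 1
    have "t \<le> card (col ` edges_at (edges F) x) + card (c ` edges_at T x)"
      using z(2) old_new[of x] card_Un_le[of "col ` edges_at (edges F) x" "c ` edges_at T x"] 1
      by simp
    also have "card (c ` edges_at T x) \<le> card (edges_at T x)"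
      using finT by (intro card_image_le) simp
    finally show False using less by simp
  next
    case 2
    have "c ` edges_at T y \<subseteq> D" using gD by (auto simp: c_def P_def)
    then have "col ` edges_at (edges F) y \<union> c ` edges_at T y \<subseteq> D"
      by (auto simp: D_def B_def)
    then have "card (override_on c col (edges F) ` edges_at (edges F \<union> T) y) \<le> card D"
      unfolding old_new using D(1) card_mono by blast
    with z(2) 2 D(3) \<open>t > 0\<close> show False by simp
  qed
qed

text \<open>Double counting: in the degree sum over \<open>X\<close>, an edge meeting
  \<open>X\<close> counts once, and a second time exactly if both its ends lie in
  \<open>X\<close>.\<close>

lemma card_edges_meeting:
  assumes E: "E \<subseteq> nsets V 2" "finite E" and "finite X"
    and deg: "\<And>x. x \<in> X \<Longrightarrow> d \<le> card (edges_at E x)"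
  shows "card X * d \<le> card {e \<in> E. e \<inter> X \<noteq> {}} + card {e \<in> E. e \<subseteq> X}"
proof -
  have "card X * d \<le> (\<Sum>x\<in>X. card (edges_at E x))"
    using sum_bounded_below[of X d "\<lambda>x. card (edges_at E x)"] deg by simp
  also have "\<dots> = (\<Sum>x\<in>X. \<Sum>e\<in>E. if x \<in> e then 1 else 0)"
    using E(2) by (simp add: edges_at_def sum.inter_filter[symmetric])
  also have "\<dots> = (\<Sum>e\<in>E. \<Sum>x\<in>X. if x \<in> e then 1 else 0)"
    by (rule sum.swap)
  also have "\<dots> = (\<Sum>e\<in>E. card {x \<in> X. x \<in> e})"
    using \<open>finite X\<close> by (simp add: sum.inter_filter[symmetric])
  also have "\<dots> \<le> (\<Sum>e\<in>E. (if e \<inter> X \<noteq> {} then 1 else 0) + (if e \<subseteq> X then 1 else 0))"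
  proof (rule sum_mono)
    fix e assume "e \<in> E"
    then have card_e: "finite e" "card e = 2" using E(1) by (auto simp: nsets_def)
    have eq: "{x \<in> X. x \<in> e} = e \<inter> X" by blast
    show "card {x \<in> X. x \<in> e} \<le> (if e \<inter> X \<noteq> {} then 1 else 0) + (if e \<subseteq> X then 1 else 0)"
    proof (cases "e \<subseteq> X")
      case True
      with card_e show ?thesis unfolding eq by (auto simp: Int_absorb2)
    next
      case False
      then have "e \<inter> X \<subset> e" by blast
      then have "card (e \<inter> X) < 2" using card_e psubset_card_mono by metis
      with False show ?thesis unfolding eq by (auto simp: card_eq_0_iff)
    qed
  qed
  also have "\<dots> = card {e \<in> E. e \<inter> X \<noteq> {}} + card {e \<in> E. e \<subseteq> X}"
    using E(2) by (simp add: sum.distrib sum.inter_filter[symmetric])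
  finally show ?thesis .
qed

lemma two_times_choose_two: "2 * (n choose 2) = n * (n - 1)"
proof -
  have "even (n * (n - 1))" by (cases n) auto
  then show ?thesis by (simp add: choose_two)
qed

text \<open>By contradiction. The estimates are kept in doubled form, which removes the division
  hidden in the binomial coefficients; the size of the vertex set serves to find an isolated
  vertex.\<close>

lemma star_saturated_lower_bound:
  fixes F :: "'a ugraph" and C :: "'c set"
  assumes C: "infinite C" and "t > 0" and n: "t * (t + 1) \<le> card (verts F)"
    and sat: "weakly_rainbow_saturated C (star (Suc t)) F col"
  shows "(Suc t choose 2) - 1 \<le> card (edges F)"
proof (rule ccontr)
  assume few: "\<not> ?thesis"
  let ?E = "edges F" and ?N = "non_edges F"
  have F: "simple_graph F" and col: "col \<in> ?E \<rightarrow> C"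
    using sat by (auto simp: weakly_rainbow_saturated_def)
  obtain es where es: "distinct es" "set es = ?N"
    and cop: "\<And>c i. c \<in> ?N \<rightarrow> C \<Longrightarrow> inj_on c ?N \<Longrightarrow> i < length es \<Longrightarrow>
      has_rainbow_copy_containing (star (Suc t)) (add_edges F (set (take (Suc i) es)))
        (override_on c col ?E) (es ! i)"
    using sat unfolding weakly_rainbow_saturated_def by blast
  have finV: "finite (verts F)" and E2: "?E \<subseteq> nsets (verts F) 2" and N2: "?N \<subseteq> nsets (verts F) 2"
    using F by (auto simp: simple_graph_def non_edges_def)
  have finE: "finite ?E" using F by (rule simple_graph_finite_edges)
  have finN: "finite ?N" using N2 finite_nsets2[OF finV] finite_subset by blast
  have few2: "2 * card ?E + 2 < t * (t + 1)"
    using few two_times_choose_two[of "Suc t"] by (auto simp: mult.commute)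

  \<comment> \<open>The vertices that see \<open>t\<close> colors in \<open>F\<close>\<close>
  define p where "p i v = card (edges_at (set (take i es)) v)" for i v
  define S where "S = {v \<in> verts F. t \<le> card (col ` edges_at ?E v)}"
  have finS: "finite S" using finV by (simp add: S_def)
  have degS: "t \<le> card (edges_at ?E v)" if "v \<in> S" for v
    using that card_image_le[of "edges_at ?E v" col] finE by (simp add: S_def)
  have meetS: "2 * (card S' * t) \<le> 2 * card {e \<in> ?E. e \<inter> S' \<noteq> {}} + card S' * (card S' - 1)"
    if "S' \<subseteq> S" for S'
  proof -
    have "finite S'" using that finS finite_subset by blast
    \<comment> \<open>Only edges inside \<open>S'\<close> are counted twice, and there are at most
      \<open>card S' choose 2\<close> of them.\<close>
    have "card S' * t \<le> card {e \<in> ?E. e \<inter> S' \<noteq> {}} + card {e \<in> ?E. e \<subseteq> S'}"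
      using card_edges_meeting[OF E2 finE \<open>finite S'\<close>, of t] degS that by blast
    also have "card {e \<in> ?E. e \<subseteq> S'} \<le> card (nsets S' 2)"
      using E2 finite_nsets2[OF \<open>finite S'\<close>] by (intro card_mono) (auto simp: nsets_def)
    also have "card (nsets S' 2) = card S' choose 2"
      by simp
    finally show ?thesis using two_times_choose_two[of "card S'"] by linarith
  qed
  have "card S < t - 1"
  proof (rule ccontr)
    assume "\<not> card S < t - 1"
    then obtain S' where S': "S' \<subseteq> S" "card S' = t - 1"
      by (meson not_less obtain_subset_with_card_n)
    have "card {e \<in> ?E. e \<inter> S' \<noteq> {}} \<le> card ?E"
      using finE by (intro card_mono) auto
    \<comment> \<open>For \<open>t - 1\<close> vertices the estimate reads
      \<open>2 * card ?E \<ge> (t - 1) * (t + 2) = t * (t + 1) - 2\<close>, exactly what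
      \<open>few2\<close> denies.\<close>
    with meetS[OF S'(1)] few2 have "2 * ((t - 1) * t) + 2 < t * (t + 1) + (t - 1) * (t - 1 - 1)"
      unfolding S'(2) by linarith
    then show False
      using \<open>t > 0\<close> by (cases t; cases "t - 1") (auto simp: algebra_simps)
  qed
  then obtain q where q: "t = Suc (card S + q)" "q > 0"
    using that[of "t - 1 - card S"] by simp

  \<comment> \<open>Old and new edges from \<open>x\<close> to \<open>S\<close> are bounded
    together, not separately. Hence \<open>t = card S + q + 1\<close> edges at \<open>x\<close>
    include at least \<open>q + 1\<close> that avoid \<open>S\<close>.\<close>
  have other_end: "card (edges_at {e \<in> ?E \<union> ?N. e \<inter> S \<noteq> {}} x) \<le> card S" if "x \<notin> S" for x
  proof -
    have "edges_at {e \<in> ?E \<union> ?N. e \<inter> S \<noteq> {}} x \<subseteq> (\<lambda>w. {x, w}) ` S"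
    proof
      fix e assume "e \<in> edges_at {e \<in> ?E \<union> ?N. e \<inter> S \<noteq> {}} x"
      then have e: "e \<in> nsets (verts F) 2" "x \<in> e" "e \<inter> S \<noteq> {}"
        using E2 N2 by (auto simp: edges_at_def)
      from e(1,2) obtain w where "e = {x, w}" by (rule nsets2_cases)
      with e(3) that show "e \<in> (\<lambda>w. {x, w}) ` S" by auto
    qed
    then have "card (edges_at {e \<in> ?E \<union> ?N. e \<inter> S \<noteq> {}} x) \<le> card ((\<lambda>w. {x, w}) ` S)"
      using finS by (intro card_mono) auto
    also have "\<dots> \<le> card S" using finS by (rule card_image_le)
    finally show ?thesis .
  qed

  \<comment> \<open>The first vertex outside \<open>S\<close> with \<open>t\<close> new
    edges\<close>
  have "\<exists>i v. v \<in> verts F - S \<and> t \<le> p i v"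
  proof -
    \<comment> \<open>The edges cover at most \<open>2 * card ?E < card (verts F)\<close> vertices,
      so some vertex is isolated; in the end all its \<open>card (verts F) - 1\<close> edges are
      new.\<close>
    have "card (\<Union> ?E) \<le> sum card ?E"
      by (rule card_Union_le_sum_card)
    also have "\<dots> = 2 * card ?E" using E2 by (simp add: nsets_def subset_eq)
    also have "\<dots> < card (verts F)" using few2 n by linarith
    finally have "card (\<Union> ?E) < card (verts F)" .
    moreover have "finite (\<Union> ?E)"
      using E2 finE by (auto simp: nsets_def)
    ultimately have "\<not> verts F \<subseteq> \<Union> ?E"
      by (meson card_mono not_less)
    then obtain v where v: "v \<in> verts F" "v \<notin> \<Union> ?E"
      by blast
    have "edges_at ?E v = {}" using v(2) by (auto simp: edges_at_def)
    then have "v \<notin> S" using \<open>t > 0\<close> by (simp add: S_def)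
    have "(\<lambda>w. {v, w}) ` (verts F - {v}) \<subseteq> edges_at ?N v"
      using v by (auto simp: edges_at_def non_edges_def intro: doubleton_in_nsets)
    then have "card ((\<lambda>w. {v, w}) ` (verts F - {v})) \<le> card (edges_at ?N v)"
      using finN by (intro card_mono) auto
    moreover have "card ((\<lambda>w. {v, w}) ` (verts F - {v})) = card (verts F) - 1"
      using v by (simp add: card_image inj_on_doubleton)
    moreover have "t \<le> card (verts F) - 1"
      using few2 n \<open>t > 0\<close> q by (cases t) auto
    ultimately have "t \<le> p (length es) v" by (simp add: p_def es(2))
    with v(1) \<open>v \<notin> S\<close> show ?thesis by blast
  qed
  define i where "i = (LEAST i. \<exists>v. v \<in> verts F - S \<and> t \<le> p i v)"
  obtain u where u: "u \<in> verts F - S" "t \<le> p i u"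
    using LeastI_ex[OF \<open>\<exists>i v. v \<in> verts F - S \<and> t \<le> p i v\<close>] unfolding i_def by blast
  have before: "p j v < t" if "j < i" "v \<in> verts F - S" for j v
    using that not_less_Least[of j "\<lambda>i. \<exists>v. v \<in> verts F - S \<and> t \<le> p i v"]
    unfolding i_def by (meson not_less)
  have "i \<noteq> 0"
  proof
    assume "i = 0"
    with u(2) \<open>t > 0\<close> show False by (simp add: p_def edges_at_def)
  qed
  \<comment> \<open>The adversary applies only while every vertex outside \<open>S\<close> has fewer
    than \<open>t\<close> new edges, that is, up to time \<open>j\<close>. Stepping back from
    \<open>i\<close> to \<open>j\<close> costs \<open>u\<close> at most one edge.\<close>
  then obtain j where j: "i = Suc j" by (cases i) auto
  have u_deg: "t - 1 \<le> p j u"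
  proof -
    have "edges_at (set (take (Suc j) es)) u \<subseteq>
        edges_at (set (take j es)) u \<union> {es ! j}"
      by (cases "j < length es") (auto simp: edges_at_def take_Suc_conv_app_nth)
    then have "p (Suc j) u \<le> card (edges_at (set (take j es)) u \<union> {es ! j})"
      unfolding p_def by (intro card_mono) auto
    also have "\<dots> \<le> p j u + 1"
      unfolding p_def by (metis card_Un_le card.empty card_insert_disjoint empty_iff finite.emptyI One_nat_def)
    finally show ?thesis using u(2) j by simp
  qed

  \<comment> \<open>Degrees in \<open>F\<close> outside \<open>S\<close>\<close>
  define E0 where "E0 = {e \<in> ?E. e \<inter> S = {}}"
  have finE0: "finite E0" using finE by (simp add: E0_def)
  have E02: "E0 \<subseteq> nsets (verts F) 2" using E2 by (auto simp: E0_def)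
  text \<open>At the first new edge at \<open>x\<close> that avoids \<open>S\<close>, all other new edges at \<open>x\<close> go to \<open>S\<close>.\<close>
  have E0_deg: "q \<le> card (edges_at E0 x)"
    if "e \<in> set (take j es)" "e \<inter> S = {}" "x \<in> e" for e x
  proof -
    define Q where "Q m \<longleftrightarrow> m < j \<and> m < length es \<and> x \<in> es ! m \<and> es ! m \<inter> S = {}" for m
    have "\<exists>m. Q m"
      using that by (auto simp: Q_def in_set_conv_nth)
    define m where "m = (LEAST m. Q m)"
    have m: "m < j" "m < length es" "x \<in> es ! m" "es ! m \<inter> S = {}"
      using LeastI_ex[OF \<open>\<exists>m. Q m\<close>] by (auto simp: m_def Q_def)
    have first: "\<not> Q m'" if "m' < m" for m'
      using that not_less_Least unfolding m_def by blast
    define T where "T = set (take (Suc m) es)"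
    have TN: "T \<subseteq> ?N" using es(2) set_take_subset by (fastforce simp: T_def)
    have mT: "es ! m \<in> T" using m by (auto simp: T_def take_Suc_conv_app_nth)
    have em: "es ! m \<subseteq> verts F - S"
      using mT TN N2 m(4) by (auto simp: nsets_def)
    have "t \<le> card (col ` edges_at ?E x) + card (edges_at T x)"
    proof (rule adversary[OF F C col \<open>t > 0\<close> TN mT m(3)])
      fix c assume "c \<in> ?N \<rightarrow> C" "inj_on c ?N"
      then show "has_rainbow_copy_containing (star (Suc t)) (add_edges F T)
          (override_on c col ?E) (es ! m)"
        unfolding T_def using cop m(2) by blast
    next
      fix z assume "z \<in> es ! m"
      with em have z: "z \<in> verts F - S" by blast
      then show "card (col ` edges_at ?E z) < t" by (auto simp: S_def)
      show "card (edges_at T z) < t"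
        using before[of "Suc m" z] z m(1) j by (simp add: p_def T_def)
    qed
    also have "card (col ` edges_at ?E x) \<le> card (edges_at ?E x)"
      using finE by (intro card_image_le) simp
    also have "edges_at ?E x = edges_at E0 x \<union> edges_at {e \<in> ?E. e \<inter> S \<noteq> {}} x"
      by (auto simp: edges_at_def E0_def)
    also have "card \<dots> \<le> card (edges_at E0 x) + card (edges_at {e \<in> ?E. e \<inter> S \<noteq> {}} x)"
      by (rule card_Un_le)
    finally have le1: "t \<le> card (edges_at E0 x) + card (edges_at {e \<in> ?E. e \<inter> S \<noteq> {}} x)
        + card (edges_at T x)"
      by simp
    have "edges_at T x \<subseteq> insert (es ! m) (edges_at {e \<in> T. e \<inter> S \<noteq> {}} x)"
    proof
      fix e assume e: "e \<in> edges_at T x"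
      then obtain m' where m': "m' \<le> m" "e = es ! m'"
        using m(2) by (auto simp: T_def edges_at_def in_set_conv_nth less_Suc_eq_le)
      show "e \<in> insert (es ! m) (edges_at {e \<in> T. e \<inter> S \<noteq> {}} x)"
      proof (cases "m' = m")
        case False
        then have "e \<inter> S \<noteq> {}"
          using first[of m'] m' m e by (auto simp: Q_def edges_at_def)
        with e show ?thesis by (auto simp: edges_at_def)
      qed (use m' in simp)
    qed
    then have "card (edges_at T x) \<le> card (insert (es ! m) (edges_at {e \<in> T. e \<inter> S \<noteq> {}} x))"
      by (intro card_mono) (auto simp: T_def)
    also have "\<dots> \<le> Suc (card (edges_at {e \<in> T. e \<inter> S \<noteq> {}} x))"
      by (rule card_insert_le_m1) auto
    finally have le2: "card (edges_at T x) \<le> Suc (card (edges_at {e \<in> T. e \<inter> S \<noteq> {}} x))" .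
    \<comment> \<open>Old and new edges from \<open>x\<close> to \<open>S\<close> are disjoint
      families, so together they number at most \<open>card S\<close>. With \<open>le1\<close> and
      \<open>le2\<close>, \<open>t\<close> is at most the degree of \<open>x\<close> in
      \<open>E0\<close> plus \<open>card S + 1\<close>, which leaves \<open>q\<close> for
      \<open>E0\<close>.\<close>
    have "card (edges_at {e \<in> ?E. e \<inter> S \<noteq> {}} x) + card (edges_at {e \<in> T. e \<inter> S \<noteq> {}} x)
        = card (edges_at {e \<in> ?E. e \<inter> S \<noteq> {}} x \<union> edges_at {e \<in> T. e \<inter> S \<noteq> {}} x)"
      using finE TN by (intro card_Un_disjoint[symmetric]) (auto simp: T_def edges_at_def non_edges_def)
    also have "\<dots> \<le> card (edges_at {e \<in> ?E \<union> ?N. e \<inter> S \<noteq> {}} x)"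
      using finE finN TN by (intro card_mono) (auto simp: edges_at_def)
    also have "\<dots> \<le> card S"
      using m(3,4) by (intro other_end) auto
    finally show ?thesis using le1 le2 q(1) by linarith
  qed

  \<comment> \<open>Counting the edges of \<open>F\<close> outside \<open>S\<close>\<close>
  define R where "R = edges_at {e \<in> set (take j es). e \<inter> S = {}} u"
  have "q \<le> card R"
  proof -
    have TN: "set (take j es) \<subseteq> ?N" using es(2) set_take_subset by fastforce
    have "edges_at (set (take j es)) u \<subseteq> R \<union> edges_at {e \<in> ?E \<union> ?N. e \<inter> S \<noteq> {}} u"
      using TN by (auto simp: R_def edges_at_def)
    \<comment> \<open>Of the at least \<open>t - 1 = card S + q\<close> new edges at
      \<open>u\<close>, at most \<open>card S\<close> go to \<open>S\<close>.\<close>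
    then have "p j u \<le> card (R \<union> edges_at {e \<in> ?E \<union> ?N. e \<inter> S \<noteq> {}} u)"
      unfolding p_def using finE finN by (intro card_mono) (auto simp: R_def)
    also have "\<dots> \<le> card R + card (edges_at {e \<in> ?E \<union> ?N. e \<inter> S \<noteq> {}} u)"
      by (rule card_Un_le)
    also have "\<dots> \<le> card R + card S"
      using other_end[of u] u by simp
    finally show ?thesis using u_deg q by linarith
  qed
  then obtain R' where R': "R' \<subseteq> R" "card R' = q"
    by (meson obtain_subset_with_card_n)
  have R'N: "R' \<subseteq> edges_at (nsets (verts F) 2) u" "R' \<inter> ?E = {}"
    using R'(1) es(2) N2 by (auto simp: R_def edges_at_def non_edges_def dest!: in_set_takeD)
  define U where "U = \<Union> R'"
  \<comment> \<open>The \<open>q\<close> edges of \<open>R'\<close> form a star with center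
    \<open>u\<close>, which has \<open>q + 1\<close> vertices.\<close>
  have cardU: "card U = Suc q" and finU: "finite U"
  proof -
    obtain f where "bij_betw f U {..<Suc q}"
      using spanned_star_isomorphic[OF R'N(1) R'(2) q(2)]
      by (auto simp: isomorphic_def star_def U_def)
    then show "card U = Suc q" "finite U"
      using bij_betw_same_card bij_betw_finite by fastforce+
  qed
  have "q * Suc q \<le> card {e \<in> E0. e \<inter> U \<noteq> {}} + card {e \<in> E0. e \<subseteq> U}"
  proof -
    \<comment> \<open>Every vertex of \<open>U\<close>, including \<open>u\<close>, is an end of an
      edge of \<open>R'\<close>, so \<open>E0_deg\<close> applies to it.\<close>
    have "q \<le> card (edges_at E0 x)" if "x \<in> U" for x
      using that R'(1) E0_deg by (auto simp: U_def R_def edges_at_def)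
    from card_edges_meeting[OF E02 finE0 finU this] show ?thesis
      by (simp add: cardU mult.commute)
  qed
  also have "card {e \<in> E0. e \<inter> U \<noteq> {}} \<le> card E0"
    using finE0 by (intro card_mono) auto
  finally have le3: "q * Suc q \<le> card E0 + card {e \<in> E0. e \<subseteq> U}" by simp
  \<comment> \<open>The new edges in \<open>R'\<close> occupy \<open>q\<close> pairs inside
    \<open>U\<close> that \<open>E0\<close> misses. This limits the edges of \<open>E0\<close> that
    were counted twice.\<close>
  have "{e \<in> E0. e \<subseteq> U} \<union> R' \<subseteq> nsets U 2"
    using E02 R'N by (auto simp: nsets_def U_def edges_at_def)
  then have "card ({e \<in> E0. e \<subseteq> U} \<union> R') \<le> Suc q choose 2"
    using card_mono[OF finite_nsets2[OF finU]] by (simp add: cardU)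
  moreover have "card ({e \<in> E0. e \<subseteq> U} \<union> R') = card {e \<in> E0. e \<subseteq> U} + q"
  proof -
    have "finite R'" using R'(2) q(2) by (auto intro: card_ge_0_finite)
    moreover have "{e \<in> E0. e \<subseteq> U} \<inter> R' = {}"
      using R'N(2) by (auto simp: E0_def)
    ultimately show ?thesis
      using finE0 R'(2) by (simp add: card_Un_disjoint)
  qed
  ultimately have le4: "2 * card {e \<in> E0. e \<subseteq> U} + 2 * q \<le> q * Suc q"
    using two_times_choose_two[of "Suc q"] by (simp add: mult.commute)
  have "?E = {e \<in> ?E. e \<inter> S \<noteq> {}} \<union> E0" by (auto simp: E0_def)
  then have "card ?E = card {e \<in> ?E. e \<inter> S \<noteq> {}} + card E0"
    using finE finE0 card_Un_disjoint[of "{e \<in> ?E. e \<inter> S \<noteq> {}}" E0] by (auto simp: E0_def)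
  with meetS[OF subset_refl] le3 le4 few2
  have "2 * (card S * t) + q * Suc q + 2 * q + 2 < t * (t + 1) + card S * (card S - 1)"
    by linarith
  \<comment> \<open>After substituting for \<open>t\<close>, both sides agree, so the strict
    inequality fails. The case split handles the truncated \<open>card S - 1\<close>.\<close>
  then show False
    unfolding q(1) by (cases "card S") (auto simp: algebra_simps)
qed

section \<open>Extremal graphs\<close>

text \<open>The core is \<open>{..<t - 1}\<close>. The deleted edge joins the two clique vertices
  outside it, so each core vertex keeps degree \<open>t\<close>.\<close>

definition clique_minus_edge :: "nat \<Rightarrow> nat \<Rightarrow> nat ugraph" where
  "clique_minus_edge n t = \<lparr>verts = {..<n}, edges = nsets {..t} 2 - {{t - 1, t}}\<rparr>"

text \<open>Obtained from \<open>clique_minus_edge\<close> by moving the edge from \<open>0\<close>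
  to \<open>t\<close> over to the fresh vertex \<open>Suc t\<close>. This preserves the number of
  edges and the core degrees but uses one more vertex.\<close>

definition clique_with_pendant :: "nat \<Rightarrow> nat \<Rightarrow> nat ugraph" where
  "clique_with_pendant n t =
     \<lparr>verts = {..<n}, edges = insert {0, Suc t} (nsets {..t} 2 - {{t - 1, t}, {0, t}})\<rparr>"

lemma card_edges_clique_minus_edge:
  assumes "t > 0" shows "card (edges (clique_minus_edge n t)) = (Suc t choose 2) - 1"
proof -
  have "{t - 1, t} \<in> nsets {..t} 2" using assms by (intro doubleton_in_nsets) auto
  then show ?thesis
    by (simp add: clique_minus_edge_def finite_nsets2)
qed

lemma card_edges_clique_with_pendant:
  assumes "t > 2" shows "card (edges (clique_with_pendant n t)) = (Suc t choose 2) - 1"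
proof -
  have sub: "{{t - 1, t}, {0, t}} \<subseteq> nsets {..t} 2"
    using assms by (auto intro: doubleton_in_nsets)
  then have "card {{t - 1, t}, {0, t}} \<le> card (nsets {..t} 2)"
    by (intro card_mono finite_nsets2) auto
  moreover have "{t - 1, t} \<noteq> {0, t}" using assms by (auto simp: doubleton_eq_iff)
  moreover have "{0, Suc t} \<notin> nsets {..t} 2" by (simp add: nsets_def)
  ultimately show ?thesis
    using sub by (simp add: clique_with_pendant_def finite_nsets2 card_Diff_subset)
qed

lemma Union_edges_clique_minus_edge:
  assumes "t > 2" shows "\<Union> (edges (clique_minus_edge n t)) = {..t}"
proof (intro equalityI subsetI)
  fix x assume "x \<in> \<Union> (edges (clique_minus_edge n t))"
  then show "x \<in> {..t}" by (auto simp: clique_minus_edge_def nsets_def)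
next
  fix x assume x: "x \<in> {..t}"
  define y :: nat where "y = (if x = 0 then 1 else 0)"
  have "{x, y} \<in> nsets {..t} 2" "{x, y} \<noteq> {t - 1, t}"
    using x assms by (auto simp: y_def doubleton_eq_iff intro!: doubleton_in_nsets)
  then have "{x, y} \<in> edges (clique_minus_edge n t)"
    by (simp add: clique_minus_edge_def)
  then show "x \<in> \<Union> (edges (clique_minus_edge n t))"
    by blast
qed

lemma Union_edges_clique_with_pendant:
  assumes "t > 2" shows "\<Union> (edges (clique_with_pendant n t)) = {..Suc t}"
proof (intro equalityI subsetI)
  fix x assume "x \<in> \<Union> (edges (clique_with_pendant n t))"
  then show "x \<in> {..Suc t}" by (auto simp: clique_with_pendant_def nsets_def)
next
  fix x assume x: "x \<in> {..Suc t}"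
  show "x \<in> \<Union> (edges (clique_with_pendant n t))"
  proof (cases "x = 0 \<or> x = Suc t")
    case False
    \<comment> \<open>For \<open>t > 2\<close> the vertex \<open>1\<close> lies in the core and is
      untouched by the moved edge, so it is a neighbour of every other vertex of the clique, even of
      \<open>t\<close>.\<close>
    define y :: nat where "y = (if x = 1 then 2 else 1)"
    have "{x, y} \<in> nsets {..t} 2" "{x, y} \<noteq> {t - 1, t}" "{x, y} \<noteq> {0, t}"
      using x False assms by (auto simp: y_def doubleton_eq_iff intro!: doubleton_in_nsets)
    then have "{x, y} \<in> edges (clique_with_pendant n t)"
      by (simp add: clique_with_pendant_def)
    then show ?thesis by blast
  qed (auto simp: clique_with_pendant_def)
qed

lemma clique_minus_edge_degree:
  assumes "v < t - 1" shows "t \<le> card (edges_at (edges (clique_minus_edge n t)) v)"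
proof -
  have "(\<lambda>w. {v, w}) ` ({..t} - {v}) \<subseteq> edges_at (edges (clique_minus_edge n t)) v"
    using assms by (auto simp: edges_at_def clique_minus_edge_def doubleton_eq_iff intro!: doubleton_in_nsets)
  then have "card ((\<lambda>w. {v, w}) ` ({..t} - {v})) \<le> card (edges_at (edges (clique_minus_edge n t)) v)"
    by (intro card_mono) (auto simp: clique_minus_edge_def finite_nsets2)
  then show ?thesis
    using assms by (simp add: card_image inj_on_doubleton)
qed

lemma clique_with_pendant_degree:
  assumes "v < t - 1" shows "t \<le> card (edges_at (edges (clique_with_pendant n t)) v)"
proof -
  define W where "W = (if v = 0 then {1..<t} \<union> {Suc t} else {..t} - {v})"
  have "{v, w} \<in> edges (clique_with_pendant n t)" if "w \<in> W" for w
  proof (cases "v = 0 \<and> w = Suc t")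
    case False
    then have "{v, w} \<in> nsets {..t} 2" "{v, w} \<noteq> {t - 1, t}" "{v, w} \<noteq> {0, t}"
      using that assms by (auto simp: W_def doubleton_eq_iff split: if_splits intro!: doubleton_in_nsets)
    then show ?thesis by (simp add: clique_with_pendant_def)
  qed (simp add: clique_with_pendant_def)
  then have "(\<lambda>w. {v, w}) ` W \<subseteq> edges_at (edges (clique_with_pendant n t)) v"
    by (auto simp: edges_at_def)
  then have "card ((\<lambda>w. {v, w}) ` W) \<le> card (edges_at (edges (clique_with_pendant n t)) v)"
    by (intro card_mono) (auto simp: clique_with_pendant_def finite_nsets2)
  moreover have "card W = t"
    using assms by (auto simp: W_def)
  ultimately show ?thesis
    by (simp add: card_image inj_on_doubleton)
qed

text \<open>An injective coloring of \<open>F\<close> exists because \<open>C\<close> is infinite.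
  The core is \<open>{..<t - 1}\<close>, and \<open>{t + 2..<n}\<close> supplies at least
  \<open>t\<close> isolated vertices.\<close>

lemma core_saturated:
  fixes F :: "nat ugraph" and C :: "'c set"
  assumes "infinite C" "t > 0" "2 * t + 2 \<le> n"
    and "verts F = {..<n}" "simple_graph F" "\<Union> (edges F) \<subseteq> {..Suc t}"
    and "\<And>v. v < t - 1 \<Longrightarrow> t \<le> card (edges_at (edges F) v)"
  shows "\<exists>col. weakly_rainbow_saturated C (star (Suc t)) F col"
proof -
  have fin: "finite (edges F)" using assms by (intro simple_graph_finite_edges)
  obtain D where D: "finite D" "card D = card (edges F)" "D \<subseteq> C"
    using infinite_arbitrarily_large[OF assms(1)] by blast
  then obtain col where col: "bij_betw col (edges F) D"
    using fin finite_same_card_bij by metis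
  have "weakly_rainbow_saturated C (star (Suc t)) F col"
  proof (rule weakly_rainbow_saturated_starI[where S = "{..<t - 1}" and I = "{t + 2..<n}"])
    show "inj_on col (edges F)" "col \<in> edges F \<rightarrow> C"
      using col D(3) by (auto simp: bij_betw_def)
    show "edges_at (edges F) v = {}" if "v \<in> {t + 2..<n}" for v
      using that assms(6) by (fastforce simp: edges_at_def)
  qed (use assms in auto)
  then show ?thesis by blast
qed

theorem theorem1p3:
  fixes n l :: nat and C :: "'c set"
  assumes "infinite C" and "l \<ge> 6" and "n \<ge> 3 * l ^ 2"
  shows "rwsat C n (star l) = (l choose 2) - 1 \<and>
    (\<exists>(F\<^sub>1 :: nat ugraph) (F\<^sub>2 :: nat ugraph).
       card (verts F\<^sub>1) = n \<and> card (verts F\<^sub>2) = n \<and>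
       card (edges F\<^sub>1) = (l choose 2) - 1 \<and> card (edges F\<^sub>2) = (l choose 2) - 1 \<and>
       (\<exists>col. weakly_rainbow_saturated C (star l) F\<^sub>1 col) \<and>
       (\<exists>col. weakly_rainbow_saturated C (star l) F\<^sub>2 col) \<and>
       \<not> isomorphic F\<^sub>1 F\<^sub>2)"
proof -
  obtain t where t: "l = Suc t" "t > 2"
    using assms(2) by (cases l) auto
  \<comment> \<open>In turn: enough isolated vertices for the upper bound, the size required by the
    lower bound, and room for the vertex \<open>Suc t\<close>.\<close>
  have n: "2 * t + 2 \<le> n" "t * (t + 1) \<le> n" "Suc t < n"
    using assms(3) t by (auto simp: power2_eq_square algebra_simps)
  let ?F1 = "clique_minus_edge n t" and ?F2 = "clique_with_pendant n t"
  have verts: "verts ?F1 = {..<n}" "verts ?F2 = {..<n}"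
    by (simp_all add: clique_minus_edge_def clique_with_pendant_def)
  have simple: "simple_graph ?F1" "simple_graph ?F2"
    using n by (auto simp: simple_graph_def clique_minus_edge_def clique_with_pendant_def nsets_def)
  have sat1: "\<exists>col. weakly_rainbow_saturated C (star l) ?F1 col"
    unfolding t(1) using assms(1) t n verts simple clique_minus_edge_degree
    by (intro core_saturated) (auto simp: Union_edges_clique_minus_edge)
  have sat2: "\<exists>col. weakly_rainbow_saturated C (star l) ?F2 col"
    unfolding t(1) using assms(1) t n verts simple clique_with_pendant_degree
    by (intro core_saturated) (auto simp: Union_edges_clique_with_pendant)
  have card1: "card (edges ?F1) = (l choose 2) - 1"
    unfolding t(1) using t by (intro card_edges_clique_minus_edge) simp
  have card2: "card (edges ?F2) = (l choose 2) - 1"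
    unfolding t(1) using t by (intro card_edges_clique_with_pendant)
  \<comment> \<open>The graphs have \<open>t + 1\<close> and \<open>t + 2\<close> non-isolated
    vertices.\<close>
  have "\<not> isomorphic ?F1 ?F2"
  proof
    assume "isomorphic ?F1 ?F2"
    moreover have "edges ?F1 \<subseteq> Pow (verts ?F1)"
      using simple(1) by (auto simp: simple_graph_def nsets_def)
    ultimately have "card (\<Union> (edges ?F1)) = card (\<Union> (edges ?F2))"
      by (rule isomorphic_card_Union_edges)
    then show False
      by (simp add: Union_edges_clique_minus_edge[OF t(2)] Union_edges_clique_with_pendant[OF t(2)])
  qed
  moreover have "rwsat C n (star l) = (l choose 2) - 1"
    unfolding rwsat_def
  proof (rule Least_equality)
    show "\<exists>(F :: nat ugraph) col. card (verts F) = n \<and> weakly_rainbow_saturated C (star l) F col \<and>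
        card (edges F) = (l choose 2) - 1"
      using sat1 card1 verts by (metis card_lessThan)
  next
    fix m assume "\<exists>(F :: nat ugraph) col. card (verts F) = n \<and>
        weakly_rainbow_saturated C (star l) F col \<and> card (edges F) = m"
    then show "(l choose 2) - 1 \<le> m"
      using star_saturated_lower_bound[OF assms(1), of t] t n by auto
  qed
  ultimately show ?thesis
    using sat1 sat2 card1 card2 verts by (metis card_lessThan)
qed

end
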